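(* Let $(Y_t)_{t\in\mathbb{N}}$ be a sequence of random variables that is uniformly continuous in probability and converges in distribution, as $t\to\infty$, to a random variable $Y_\infty$. For each $\delta$, let $(\tau_n)_{n\in\mathbb{N}}$ be a renewal process of $\mathbb{N}$-valued random times, with $\tau_0=0$, with i.i.d. positive increments distributed as $\tau=\tau_1$, and with $\mathsf{E}[\tau]=\delta$. Let $N(t)=\max\{n:\tau_n\le t\}$ and $\tau(t)=\tau_{N(t)}$. If $\mathsf{E}[\tau^2]=O(\delta^2)$ as $\delta\to\infty$, or equivalently $\mathsf{Var}[\tau]=O(\delta^2)$, then $$\frac{\tau(t)}{t}\longrightarrow 1\ \text{ in } L^1\quad\text{and, consequently,}\quad Y_{\tau(t)}\longrightarrow Y_\infty\ \text{ in distribution}$$ as $\delta,t\to\infty$ so that $\delta=o(t)$.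
   Context: The sequence $(Y_t)$ is fixed (does not depend on $\delta$), while the law of $\tau$ depends on $\delta$; $(Y_t)$ and all the renewal processes live on a common probability space, and no independence between $(Y_t)$ and $(\tau_n)$ is assumed. Uniformly continuous in probability: for every $\varepsilon>0$ there is $\eta>0$ such that $\mathsf{P}\bigl(\max_{0\le k\le \eta n}|Y_{n+k}-Y_n|\ge\varepsilon\bigr)<\varepsilon$ for all $n\ge1$. If $N(t)=0$ then $\tau(t)=0$ and $Y_0$ is an arbitrary fixed random variable. A statement "as $\delta,t\to\infty$ so that $\delta=o(t)$" refers to any joint limit in which $\delta\to\infty$, $t\to\infty$ and $\delta/t\to0$. *)

theory Defs
  imports "HOL-Probability.Probability" "HOL-Library.Landau_Symbols"
begin

definition unif_cont_in_prob :: "'a measure \<Rightarrow> (nat \<Rightarrow> 'a \<Rightarrow> real) \<Rightarrow> bool" where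
  "unif_cont_in_prob M Y \<longleftrightarrow>
    (\<forall>\<epsilon>>0. \<exists>\<eta>>0. \<forall>n\<ge>1.
      measure M {\<omega> \<in> space M.
        Max ((\<lambda>k. \<bar>Y (n + k) \<omega> - Y n \<omega>\<bar>) ` {k. real k \<le> \<eta> * real n}) \<ge> \<epsilon>} < \<epsilon>)"

(* The subtraction truncates on nat; its positivity says exactly that \<tau> n \<omega> < \<tau> (Suc n) \<omega>. *)
definition increment :: "(nat \<Rightarrow> 'a \<Rightarrow> nat) \<Rightarrow> nat \<Rightarrow> 'a \<Rightarrow> nat" where
  "increment \<tau> n \<omega> = \<tau> (Suc n) \<omega> - \<tau> n \<omega>"

definition renewal_process :: "'a measure \<Rightarrow> (nat \<Rightarrow> 'a \<Rightarrow> nat) \<Rightarrow> bool" where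
  "renewal_process M \<tau> \<longleftrightarrow>
    (\<forall>n. \<tau> n \<in> measurable M (count_space UNIV)) \<and>
    (AE \<omega> in M. \<tau> 0 \<omega> = 0) \<and>
    (\<forall>n. AE \<omega> in M. increment \<tau> n \<omega> > 0) \<and>
    prob_space.indep_vars M (\<lambda>_. count_space UNIV) (increment \<tau>) UNIV \<and>
    (\<forall>n. distr M (count_space UNIV) (increment \<tau> n) = distr M (count_space UNIV) (\<tau> 1))"

definition renewal_count :: "(nat \<Rightarrow> 'a \<Rightarrow> nat) \<Rightarrow> real \<Rightarrow> 'a \<Rightarrow> nat" where
  "renewal_count \<tau> t \<omega> = Max {n. real (\<tau> n \<omega>) \<le> t}"

definition last_renewal :: "(nat \<Rightarrow> 'a \<Rightarrow> nat) \<Rightarrow> real \<Rightarrow> 'a \<Rightarrow> nat" where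
  "last_renewal \<tau> t \<omega> = \<tau> (renewal_count \<tau> t \<omega>) \<omega>"

(* E[X_\<delta>] = O(g(\<delta>)) along F for nonnegative X_\<delta>. Integrability is required explicitly because
   the Bochner integral of a non-integrable function is 0, whereas its expectation here is
   infinite and hence not O(g(\<delta>)). *)
definition expectation_bigo ::
    "'a measure \<Rightarrow> 'p filter \<Rightarrow> ('p \<Rightarrow> 'a \<Rightarrow> real) \<Rightarrow> ('p \<Rightarrow> real) \<Rightarrow> bool" where
  "expectation_bigo M F X g \<longleftrightarrow>
    (\<forall>\<^sub>F \<delta> in F. integrable M (X \<delta>)) \<and> (\<lambda>\<delta>. \<integral>\<omega>. X \<delta> \<omega> \<partial>M) \<in> O[F](g)"

definition tendsto_L1 ::
    "'a measure \<Rightarrow> 'i filter \<Rightarrow> ('i \<Rightarrow> 'a \<Rightarrow> real) \<Rightarrow> ('a \<Rightarrow> real) \<Rightarrow> bool" where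
  "tendsto_L1 M F X Z \<longleftrightarrow>
    (\<forall>\<^sub>F i in F. integrable M (X i)) \<and> integrable M Z \<and>
    ((\<lambda>i. \<integral>\<omega>. \<bar>X i \<omega> - Z \<omega>\<bar> \<partial>M) \<longlongrightarrow> 0) F"

(* The library's weak_conv_m, which is restricted to sequences, along an arbitrary filter. *)
definition weak_conv_along ::
    "'i filter \<Rightarrow> ('i \<Rightarrow> real measure) \<Rightarrow> real measure \<Rightarrow> bool" where
  "weak_conv_along F \<mu> \<nu> \<longleftrightarrow>
    (\<forall>x. isCont (cdf \<nu>) x \<longrightarrow> ((\<lambda>i. cdf (\<mu> i) x) \<longlongrightarrow> cdf \<nu> x) F)"

lemma weak_conv_along_sequentially:
  "weak_conv_along sequentially \<mu> \<nu> \<longleftrightarrow> weak_conv_m \<mu> \<nu>"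
  by (simp add: weak_conv_along_def weak_conv_m_def weak_conv_def)

(* A joint limit "d, t \<rightarrow> \<infinity> so that d = o(t)", given as a net (d i, t i) along F
   with d ranging over the set D of admissible parameters. *)
definition joint_limit ::
    "real set \<Rightarrow> 'i filter \<Rightarrow> ('i \<Rightarrow> real) \<Rightarrow> ('i \<Rightarrow> real) \<Rightarrow> bool" where
  "joint_limit D F d t \<longleftrightarrow>
    (\<forall>\<^sub>F i in F. d i \<in> D) \<and> filterlim d at_top F \<and> filterlim t at_top F \<and>
    ((\<lambda>i. d i / t i) \<longlongrightarrow> 0) F"

end

theory Submission
  imports Defs
begin

text \<open>
  Let \<open>Z\<close> be the length of the renewal interval straddling \<open>t\<close>. The \<open>k\<close>-th interval starts by
  time \<open>t\<close> on an event independent of its length, so Wald's identity applies both to the lengths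
  and to their squares: with \<open>P\<close> the expected number of intervals starting by time \<open>t\<close>,
  \<open>P * \<delta> \<le> t + E Z\<close> and \<open>E (Z\<^sup>2) \<le> P * C * \<delta>\<^sup>2\<close>. Hence
  \<open>(E Z)\<^sup>2 \<le> C * \<delta> * (t + E Z)\<close>, and \<open>0 \<le> t - \<tau>(t) \<le> Z\<close> has expectation at most
  \<open>C * \<delta> + sqrt (C * \<delta> * t)\<close>, which is \<open>o(t)\<close>. For the second claim, given \<open>\<eta>\<close> from uniform
  continuity in probability, \<open>\<tau>(t)\<close> lies with high probability between \<open>n = \<lceil>t / (1 + \<eta>)\<rceil>\<close> and
  \<open>(1 + \<eta>) * n\<close>, so \<open>Y\<close> at time \<open>\<tau>(t)\<close> is close to \<open>Y\<close> at the deterministic time \<open>n\<close>.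
\<close>

section \<open>The renewal interval straddling a time\<close>

lemma increment_pos_iff: "increment \<tau> n \<omega> > 0 \<longleftrightarrow> \<tau> n \<omega> < \<tau> (Suc n) \<omega>"
  by (simp add: increment_def)

lemma sum_increment:
  assumes "\<tau> 0 \<omega> = 0" and "\<And>n. increment \<tau> n \<omega> > 0"
  shows "(\<Sum>j<n. increment \<tau> j \<omega>) = \<tau> n \<omega>"
proof (induction n)
  case (Suc n)
  have "\<tau> n \<omega> < \<tau> (Suc n) \<omega>"
    using assms(2) by (simp add: increment_pos_iff)
  then show ?case
    using Suc by (simp add: increment_def)
qed (simp add: assms)

text \<open>Renewal times are strictly increasing naturals, so the \<open>n\<close>-th is at least
  \<open>n\<close>. The set whose maximum defines \<open>renewal_count\<close> is therefore finite,
  and it contains 0 because \<open>0 \<le> t\<close>, so \<open>Max\<close> returns a genuine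
  maximum.\<close>

lemma renewal_count_bounds:
  assumes "\<tau> 0 \<omega> = 0" and inc: "\<And>n. increment \<tau> n \<omega> > 0" and "0 \<le> t"
  shows "real (\<tau> k \<omega>) \<le> t \<longleftrightarrow> k \<le> renewal_count \<tau> t \<omega>"
    and "renewal_count \<tau> t \<omega> \<le> nat \<lfloor>t\<rfloor>"
    and "real (last_renewal \<tau> t \<omega>) \<le> t"
    and "t < real (last_renewal \<tau> t \<omega>) + real (increment \<tau> (renewal_count \<tau> t \<omega>) \<omega>)"
proof -
  define N where "N = renewal_count \<tau> t \<omega>"
  have mono: "strict_mono (\<lambda>n. \<tau> n \<omega>)"
    using inc by (simp add: strict_mono_Suc_iff increment_pos_iff)
  have le: "n \<le> nat \<lfloor>t\<rfloor>" if "real (\<tau> n \<omega>) \<le> t" for n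
    using strict_mono_imp_increasing[OF mono, of n] that by (simp add: le_nat_floor)
  have fin: "finite {n. real (\<tau> n \<omega>) \<le> t}"
    by (rule finite_subset[of _ "{..nat \<lfloor>t\<rfloor>}"]) (use le in auto)
  have "0 \<in> {n. real (\<tau> n \<omega>) \<le> t}"
    using assms by simp
  then have N: "N \<in> {n. real (\<tau> n \<omega>) \<le> t}"
    unfolding N_def renewal_count_def using fin by (intro Max_in) auto
  have upper: "k \<le> N" if "real (\<tau> k \<omega>) \<le> t" for k
    unfolding N_def renewal_count_def using fin that by (intro Max_ge) auto
  show iff: "real (\<tau> k \<omega>) \<le> t \<longleftrightarrow> k \<le> renewal_count \<tau> t \<omega>" for k
  proof
    assume "k \<le> renewal_count \<tau> t \<omega>"
    then have "\<tau> k \<omega> \<le> \<tau> N \<omega>"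
      using strict_mono_less_eq[OF mono] by (simp add: N_def)
    then show "real (\<tau> k \<omega>) \<le> t"
      using N by (simp add: order_trans[OF of_nat_mono])
  qed (use upper in \<open>simp add: N_def\<close>)
  show "renewal_count \<tau> t \<omega> \<le> nat \<lfloor>t\<rfloor>"
    using le N by (simp add: N_def)
  show "real (last_renewal \<tau> t \<omega>) \<le> t"
    using N by (simp add: N_def last_renewal_def)
  have "\<not> real (\<tau> (Suc N) \<omega>) \<le> t"
    using iff by (simp add: N_def)
  moreover have "\<tau> (Suc N) \<omega> = \<tau> N \<omega> + increment \<tau> N \<omega>"
    using inc[of N] by (simp add: increment_def)
  ultimately show "t < real (last_renewal \<tau> t \<omega>) + real (increment \<tau> (renewal_count \<tau> t \<omega>) \<omega>)"
    by (simp add: N_def last_renewal_def)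
qed

lemma renewal_process_measurable:
  assumes "renewal_process M \<tau>"
  shows "\<tau> n \<in> measurable M (count_space UNIV)"
    and "increment \<tau> n \<in> measurable M (count_space UNIV)"
    and "renewal_count \<tau> t \<in> measurable M (count_space UNIV)"
    and "last_renewal \<tau> t \<in> measurable M (count_space UNIV)"
    and "(\<lambda>\<omega>. increment \<tau> (renewal_count \<tau> t \<omega>) \<omega>) \<in> measurable M (count_space UNIV)"
proof -
  show [measurable]: "\<tau> n \<in> measurable M (count_space UNIV)" for n
    using assms by (simp add: renewal_process_def)
  show [measurable]: "increment \<tau> n \<in> measurable M (count_space UNIV)" for n
    unfolding increment_def[abs_def] by measurable
  show [measurable]: "renewal_count \<tau> t \<in> measurable M (count_space UNIV)"
    unfolding renewal_count_def[abs_def] by measurable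
  \<comment> \<open>The random index takes countably many values, so measurability can be checked
    separately for each fixed index.\<close>
  show "last_renewal \<tau> t \<in> measurable M (count_space UNIV)"
    unfolding last_renewal_def[abs_def] by (rule measurable_compose_countable) measurable
  show "(\<lambda>\<omega>. increment \<tau> (renewal_count \<tau> t \<omega>) \<omega>) \<in> measurable M (count_space UNIV)"
    by (rule measurable_compose_countable) measurable
qed

lemma renewal_process_AE:
  assumes "renewal_process M \<tau>"
  shows "AE \<omega> in M. \<tau> 0 \<omega> = 0 \<and> (\<forall>n. increment \<tau> n \<omega> > 0)"
  using assms by (simp add: renewal_process_def AE_all_countable)

section \<open>Wald's identity and the expected lag\<close>

context prob_space
begin

text \<open>Whether the \<open>k\<close>-th interval starts by time \<open>t\<close> is decided by
  the increments before \<open>k\<close>, hence independently of the \<open>k\<close>-th one. Summed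
  over \<open>k\<close>, this is Wald's identity; it is applied with \<open>g\<close> the identity
  and the square.\<close>

lemma renewal_expectation_restrict:
  fixes g :: "nat \<Rightarrow> real"
  assumes ren: "renewal_process M \<tau>" and int: "integrable M (\<lambda>\<omega>. g (\<tau> 1 \<omega>))"
  shows "integrable M (\<lambda>\<omega>. of_bool (real (\<tau> k \<omega>) \<le> t) * g (increment \<tau> k \<omega>))"
    and "expectation (\<lambda>\<omega>. of_bool (real (\<tau> k \<omega>) \<le> t) * g (increment \<tau> k \<omega>)) =
      prob {\<omega> \<in> space M. real (\<tau> k \<omega>) \<le> t} * expectation (\<lambda>\<omega>. g (\<tau> 1 \<omega>))"
proof -
  note [measurable] = renewal_process_measurable[OF ren]
  let ?S = "\<lambda>\<omega>. \<Sum>j<k. real (increment \<tau> j \<omega>)"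
  have "distr M (count_space UNIV) (increment \<tau> k) = distr M (count_space UNIV) (\<tau> 1)"
    using ren by (simp add: renewal_process_def)
  then have int': "integrable M (\<lambda>\<omega>. g (increment \<tau> k \<omega>))"
    and mean: "expectation (\<lambda>\<omega>. g (increment \<tau> k \<omega>)) = expectation (\<lambda>\<omega>. g (\<tau> 1 \<omega>))"
    using int integrable_distr_eq[of "increment \<tau> k" M "count_space UNIV" g]
      integrable_distr_eq[of "\<tau> 1" M "count_space UNIV" g]
      integral_distr[of "increment \<tau> k" M "count_space UNIV" g]
      integral_distr[of "\<tau> 1" M "count_space UNIV" g] by simp_all
  have "indep_vars (\<lambda>_. count_space UNIV) (increment \<tau>) UNIV"
    using ren by (simp add: renewal_process_def)
  then have "indep_vars (\<lambda>_. borel) (\<lambda>j \<omega>. real (increment \<tau> j \<omega>)) UNIV"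
    by (rule indep_vars_compose2) simp
  then have "indep_vars (\<lambda>_. borel) (\<lambda>j \<omega>. real (increment \<tau> j \<omega>)) (insert k {..<k})"
    by (rule indep_vars_subset) simp
  then have "indep_var borel (\<lambda>\<omega>. real (increment \<tau> k \<omega>)) borel ?S"
    by (rule indep_vars_sum[rotated 2]) auto
  \<comment> \<open>The increments were cast to reals to form \<open>?S\<close>;
    \<open>nat \<lfloor>x\<rfloor>\<close> undoes the cast inside \<open>g\<close>.\<close>
  then have "indep_var borel ((\<lambda>x. g (nat \<lfloor>x\<rfloor>)) \<circ> (\<lambda>\<omega>. real (increment \<tau> k \<omega>)))
      borel ((\<lambda>s. of_bool (s \<le> t)) \<circ> ?S)"
    by (rule indep_var_compose) measurable
  then have indep: "indep_var borel (\<lambda>\<omega>. g (increment \<tau> k \<omega>)) borel (\<lambda>\<omega>. of_bool (?S \<omega> \<le> t) :: real)"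
    by (simp add: comp_def)
  have ind: "integrable M (\<lambda>\<omega>. of_bool (?S \<omega> \<le> t) :: real)"
    by (rule integrable_const_bound[where B = 1]) auto
  \<comment> \<open>Only almost surely: start at 0 and positive increments are almost sure
    properties, and without them the truncated differences need not telescope.\<close>
  have AE: "AE \<omega> in M. ?S \<omega> = real (\<tau> k \<omega>)"
    using renewal_process_AE[OF ren]
  proof eventually_elim
    case (elim \<omega>)
    then show ?case
      by (simp add: sum_increment flip: of_nat_sum)
  qed
  have AE': "AE \<omega> in M. g (increment \<tau> k \<omega>) * of_bool (?S \<omega> \<le> t) =
      of_bool (real (\<tau> k \<omega>) \<le> t) * g (increment \<tau> k \<omega>)"
    using AE by eventually_elim simp
  have "integrable M (\<lambda>\<omega>. g (increment \<tau> k \<omega>) * of_bool (?S \<omega> \<le> t))"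
    by (rule indep_var_integrable[OF indep int' ind])
  then show "integrable M (\<lambda>\<omega>. of_bool (real (\<tau> k \<omega>) \<le> t) * g (increment \<tau> k \<omega>))"
    by (rule integrable_cong_AE_imp[OF _ _ AE']) measurable
  have "expectation (\<lambda>\<omega>. of_bool (real (\<tau> k \<omega>) \<le> t) * g (increment \<tau> k \<omega>)) =
      expectation (\<lambda>\<omega>. g (increment \<tau> k \<omega>) * of_bool (?S \<omega> \<le> t))"
    by (rule integral_cong_AE[OF _ _ AE', symmetric]) measurable
  also have "\<dots> = expectation (\<lambda>\<omega>. g (\<tau> 1 \<omega>)) * expectation (\<lambda>\<omega>. of_bool (?S \<omega> \<le> t))"
    using indep_var_lebesgue_integral[OF indep int' ind] mean by simp
  also have "expectation (\<lambda>\<omega>. of_bool (?S \<omega> \<le> t) :: real) =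
      expectation (indicator {\<omega> \<in> space M. real (\<tau> k \<omega>) \<le> t})"
    by (rule integral_cong_AE) (use AE in \<open>auto elim!: eventually_mono simp: indicator_def\<close>)
  finally show "expectation (\<lambda>\<omega>. of_bool (real (\<tau> k \<omega>) \<le> t) * g (increment \<tau> k \<omega>)) =
      prob {\<omega> \<in> space M. real (\<tau> k \<omega>) \<le> t} * expectation (\<lambda>\<omega>. g (\<tau> 1 \<omega>))"
    by simp
qed

lemma expectation_square_le:
  fixes X :: "'a \<Rightarrow> real"
  assumes "integrable M X" "integrable M (\<lambda>\<omega>. (X \<omega>)\<^sup>2)"
  shows "(expectation X)\<^sup>2 \<le> expectation (\<lambda>\<omega>. (X \<omega>)\<^sup>2)"
  using variance_positive[of X] variance_eq[OF assms] by simp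

text \<open>This bound holds for each fixed \<open>\<delta>\<close> and \<open>t\<close>. Divided by
  \<open>t\<close>, its right-hand side depends on \<open>\<delta> / t\<close> only, which is what
  the joint limit needs.\<close>

lemma renewal_lag_bound:
  assumes ren: "renewal_process M \<tau>" and t: "0 \<le> t" and C: "0 \<le> C"
    and int1: "integrable M (\<lambda>\<omega>. real (\<tau> 1 \<omega>))"
    and mean: "expectation (\<lambda>\<omega>. real (\<tau> 1 \<omega>)) = \<delta>"
    and int2: "integrable M (\<lambda>\<omega>. (real (\<tau> 1 \<omega>))\<^sup>2)"
    and second: "expectation (\<lambda>\<omega>. (real (\<tau> 1 \<omega>))\<^sup>2) \<le> C * \<delta>\<^sup>2"
  shows "integrable M (\<lambda>\<omega>. real (last_renewal \<tau> t \<omega>))"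
    and "expectation (\<lambda>\<omega>. \<bar>t - real (last_renewal \<tau> t \<omega>)\<bar>) \<le> C * \<delta> + sqrt (C * \<delta> * t)"
proof -
  note [measurable] = renewal_process_measurable[OF ren]
  \<comment> \<open>\<open>m\<close> is a deterministic bound on the renewal count, so sums up to
    the random count become fixed finite sums weighted by the indicators \<open>I\<close>. The
    number \<open>P\<close> below is the expected renewal count plus one.\<close>
  define m where "m = nat \<lfloor>t\<rfloor>"
  define I where "I k \<omega> = (of_bool (real (\<tau> k \<omega>) \<le> t) :: real)" for k \<omega>
  define Z where "Z \<omega> = real (increment \<tau> (renewal_count \<tau> t \<omega>) \<omega>)" for \<omega>
  have [measurable]: "Z \<in> borel_measurable M"
    unfolding Z_def[abs_def] by measurable
  have \<delta>: "0 \<le> \<delta>"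
    unfolding mean[symmetric] by (intro integral_nonneg_AE) simp
  define P where "P = (\<Sum>k\<le>m. prob {\<omega> \<in> space M. real (\<tau> k \<omega>) \<le> t})"
  have P: "0 \<le> P"
    by (simp add: P_def sum_nonneg)
  have intI: "integrable M (\<lambda>\<omega>. \<Sum>k\<le>m. I k \<omega> * g (increment \<tau> k \<omega>))"
    and wald: "expectation (\<lambda>\<omega>. \<Sum>k\<le>m. I k \<omega> * g (increment \<tau> k \<omega>)) =
      P * expectation (\<lambda>\<omega>. g (\<tau> 1 \<omega>))"
    if "integrable M (\<lambda>\<omega>. g (\<tau> 1 \<omega>))" for g :: "nat \<Rightarrow> real"
    using renewal_expectation_restrict[OF ren that, where t = t, folded I_def]
    by (simp_all add: P_def sum_distrib_right)
  have "AE \<omega> in M. (real (last_renewal \<tau> t \<omega>) \<le> t \<and> t \<le> real (last_renewal \<tau> t \<omega>) + Z \<omega>) \<and>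
      (\<Sum>k\<le>m. I k \<omega> * real (increment \<tau> k \<omega>)) \<le> t + Z \<omega> \<and>
      (Z \<omega>)\<^sup>2 \<le> (\<Sum>k\<le>m. I k \<omega> * (real (increment \<tau> k \<omega>))\<^sup>2)"
    using renewal_process_AE[OF ren]
  proof eventually_elim
    case (elim \<omega>)
    then have z: "\<tau> 0 \<omega> = 0" and inc: "\<And>n. increment \<tau> n \<omega> > 0"
      by auto
    define N where "N = renewal_count \<tau> t \<omega>"
    note b = renewal_count_bounds[of \<tau> \<omega>, OF z inc t]
    have sum_eq: "(\<Sum>k\<le>m. I k \<omega> * h k) = (\<Sum>k\<le>N. h k)" for h :: "nat \<Rightarrow> real"
      using b(2) by (intro sum.mono_neutral_cong_right) (auto simp: I_def b(1) N_def m_def)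
    \<comment> \<open>The sum includes the straddling interval \<open>N\<close>, so it telescopes to
      the first renewal after \<open>t\<close>.\<close>
    have "(\<Sum>k\<le>N. real (increment \<tau> k \<omega>)) = real (last_renewal \<tau> t \<omega>) + Z \<omega>"
      using sum_increment[of \<tau> \<omega> N, OF z inc]
      by (simp add: lessThan_Suc_atMost[symmetric] last_renewal_def Z_def N_def
          flip: of_nat_sum)
    moreover have "(Z \<omega>)\<^sup>2 \<le> (\<Sum>k\<le>N. (real (increment \<tau> k \<omega>))\<^sup>2)"
      using member_le_sum[of N "{..N}" "\<lambda>k. (real (increment \<tau> k \<omega>))\<^sup>2"]
      by (simp add: Z_def N_def)
    ultimately show ?case
      using b(3,4) by (simp add: sum_eq Z_def)
  qed
  then have lag: "AE \<omega> in M. real (last_renewal \<tau> t \<omega>) \<le> t \<and> t \<le> real (last_renewal \<tau> t \<omega>) + Z \<omega>"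
    and first_le: "AE \<omega> in M. (\<Sum>k\<le>m. I k \<omega> * real (increment \<tau> k \<omega>)) \<le> t + Z \<omega>"
    and square_le: "AE \<omega> in M. (Z \<omega>)\<^sup>2 \<le> (\<Sum>k\<le>m. I k \<omega> * (real (increment \<tau> k \<omega>))\<^sup>2)"
    by (simp_all only: eventually_conj_iff)
  \<comment> \<open>Domination by the Wald sum gives the square first; integrability of
    \<open>Z\<close> follows since the measure is finite.\<close>
  have intZ2: "integrable M (\<lambda>\<omega>. (Z \<omega>)\<^sup>2)"
    by (rule Bochner_Integration.integrable_bound[OF intI[of "\<lambda>n. (real n)\<^sup>2", OF int2]])
      (use square_le in \<open>auto elim!: eventually_mono\<close>)
  have intZ: "integrable M Z"
    by (rule square_integrable_imp_integrable[OF _ intZ2]) measurable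
  define z where "z = expectation Z"
  have z: "0 \<le> z"
    unfolding z_def by (intro integral_nonneg_AE) (simp add: Z_def)
  have "P * \<delta> = expectation (\<lambda>\<omega>. \<Sum>k\<le>m. I k \<omega> * real (increment \<tau> k \<omega>))"
    using wald[of real, OF int1] mean by simp
  also have "\<dots> \<le> expectation (\<lambda>\<omega>. t + Z \<omega>)"
    by (rule integral_mono_AE) (use first_le intI[of real, OF int1] intZ in auto)
  also have "\<dots> = t + z"
    using intZ by (simp add: z_def prob_space)
  finally have count: "P * \<delta> \<le> t + z" .
  have "z\<^sup>2 \<le> expectation (\<lambda>\<omega>. (Z \<omega>)\<^sup>2)"
    unfolding z_def by (rule expectation_square_le[OF intZ intZ2])
  also have "\<dots> \<le> expectation (\<lambda>\<omega>. \<Sum>k\<le>m. I k \<omega> * (real (increment \<tau> k \<omega>))\<^sup>2)"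
    by (rule integral_mono_AE)
      (use square_le intI[of "\<lambda>n. (real n)\<^sup>2", OF int2] intZ2 in auto)
  also have "\<dots> = P * expectation (\<lambda>\<omega>. (real (\<tau> 1 \<omega>))\<^sup>2)"
    by (rule wald[of "\<lambda>n. (real n)\<^sup>2", OF int2])
  also have "\<dots> \<le> P * (C * \<delta>\<^sup>2)"
    by (rule mult_left_mono[OF second P])
  \<comment> \<open>One factor \<open>\<delta>\<close> is paired with \<open>P\<close>, so that
    \<open>count\<close> turns the bound into a quadratic inequality in \<open>z\<close>
    alone.\<close>
  also have "\<dots> = C * \<delta> * (P * \<delta>)"
    by (simp add: power2_eq_square)
  also have "\<dots> \<le> C * \<delta> * (t + z)"
    using C \<delta> count by (intro mult_left_mono) auto
  finally have quad: "z * (z - C * \<delta>) \<le> C * \<delta> * t"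
    by (simp add: power2_eq_square algebra_simps)
  have z_le: "z \<le> C * \<delta> + sqrt (C * \<delta> * t)"
  proof (rule ccontr)
    define s where "s = sqrt (C * \<delta> * t)"
    have s: "0 \<le> s" "s * s = C * \<delta> * t"
      using C \<delta> t by (simp_all add: s_def)
    assume "\<not> z \<le> C * \<delta> + sqrt (C * \<delta> * t)"
    \<comment> \<open>Both factors of \<open>z * (z - C * \<delta>)\<close> then exceed
      \<open>s\<close>, so their product exceeds \<open>s * s\<close>, against
      \<open>quad\<close>.\<close>
    then have "s < z - C * \<delta>"
      by (simp add: s_def)
    moreover from this have "s < z"
      using C \<delta> by (smt (verit) mult_nonneg_nonneg)
    ultimately have "s * s < z * (z - C * \<delta>)"
      using s by (intro mult_strict_mono') auto
    with quad s show False
      by simp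
  qed
  show int: "integrable M (\<lambda>\<omega>. real (last_renewal \<tau> t \<omega>))"
    by (rule integrable_const_bound[where B = t]) (use lag in auto)
  have "expectation (\<lambda>\<omega>. \<bar>t - real (last_renewal \<tau> t \<omega>)\<bar>) \<le> z"
    unfolding z_def
  proof (rule integral_mono_AE)
    show "AE \<omega> in M. \<bar>t - real (last_renewal \<tau> t \<omega>)\<bar> \<le> Z \<omega>"
      using lag by eventually_elim auto
  qed (use int intZ in auto)
  with z_le show "expectation (\<lambda>\<omega>. \<bar>t - real (last_renewal \<tau> t \<omega>)\<bar>) \<le> C * \<delta> + sqrt (C * \<delta> * t)"
    by simp
qed

section \<open>Convergence in distribution\<close>

text \<open>If \<open>U\<close> is at most \<open>x\<close> and \<open>V\<close> is within
  \<open>\<epsilon>\<close> of it, then \<open>V\<close> is at most \<open>y\<close>. Exchanging the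
  roles of the variables gives the matching lower bound.\<close>

lemma cdf_distr_le_add_prob:
  fixes U V :: "'a \<Rightarrow> real"
  assumes [measurable]: "random_variable borel U" "random_variable borel V" and "x + \<epsilon> \<le> y"
  shows "cdf (distr M borel U) x \<le> cdf (distr M borel V) y + prob {\<omega> \<in> space M. \<bar>U \<omega> - V \<omega>\<bar> \<ge> \<epsilon>}"
proof -
  have "cdf (distr M borel U) x = prob {\<omega> \<in> space M. U \<omega> \<le> x}"
    by (simp add: cdf_def measure_distr vimage_def Int_def conj_commute)
  also have "\<dots> \<le> prob ({\<omega> \<in> space M. V \<omega> \<le> y} \<union> {\<omega> \<in> space M. \<bar>U \<omega> - V \<omega>\<bar> \<ge> \<epsilon>})"
    using assms(3) by (intro finite_measure_mono) auto
  also have "\<dots> \<le> prob {\<omega> \<in> space M. V \<omega> \<le> y} + prob {\<omega> \<in> space M. \<bar>U \<omega> - V \<omega>\<bar> \<ge> \<epsilon>}"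
    by (rule measure_Un_le) auto
  also have "prob {\<omega> \<in> space M. V \<omega> \<le> y} = cdf (distr M borel V) y"
    by (simp add: cdf_def measure_distr vimage_def Int_def conj_commute)
  finally show ?thesis .
qed

text \<open>A form of Slutsky's theorem in which the approximating variables may depend on the accuracy.\<close>

lemma weak_conv_along_approx:
  fixes U :: "'i \<Rightarrow> 'a \<Rightarrow> real" and F :: "'i filter"
  assumes \<nu>: "real_distribution \<nu>"
    and U: "\<forall>\<^sub>F i in F. random_variable borel (U i)"
    and approx: "\<And>\<epsilon>. 0 < \<epsilon> \<Longrightarrow> \<exists>V. (\<forall>i. random_variable borel (V i)) \<and>
      weak_conv_along F (\<lambda>i. distr M borel (V i)) \<nu> \<and>
      (\<forall>\<^sub>F i in F. prob {\<omega> \<in> space M. \<bar>U i \<omega> - V i \<omega>\<bar> \<ge> \<epsilon>} \<le> \<epsilon>)"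
  shows "weak_conv_along F (\<lambda>i. distr M borel (U i)) \<nu>"
  unfolding weak_conv_along_def
proof (intro allI impI tendstoI)
  fix x and e :: real
  assume cont: "isCont (cdf \<nu>) x" and e: "0 < e"
  interpret \<nu>: real_distribution \<nu> by (rule \<nu>)
  \<comment> \<open>Discontinuities of a monotone function are countable, so continuity points
    \<open>a < x < b\<close> exist arbitrarily close to \<open>x\<close>.\<close>
  have "mono (cdf \<nu>)"
    by (auto intro!: monoI \<nu>.cdf_nondecreasing)
  then have ctble: "countable {a. \<not> isCont (cdf \<nu>) a}"
    by (rule mono_ctble_discont)
  obtain r where r: "0 < r" and close: "\<And>y. dist y x < r \<Longrightarrow> dist (cdf \<nu> y) (cdf \<nu> x) < e / 3"
    using cont e unfolding continuous_at_eps_delta by (metis zero_less_divide_iff zero_less_numeral)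
  obtain a where a: "x - r < a" "a < x" "isCont (cdf \<nu>) a"
    using open_minus_countable[OF ctble, of "{x - r<..<x}"] r by auto
  obtain b where b: "x < b" "b < x + r" "isCont (cdf \<nu>) b"
    using open_minus_countable[OF ctble, of "{x<..<x + r}"] r by auto
  \<comment> \<open>The error \<open>e\<close> is split in three: the exceptional probability, the
    convergence of the laws of \<open>V i\<close> at \<open>a\<close> and \<open>b\<close>, and the
    variation of the limit cdf between these points and \<open>x\<close>.\<close>
  define \<epsilon> where "\<epsilon> = min (e / 3) (min (x - a) (b - x))"
  have \<epsilon>: "0 < \<epsilon>" "\<epsilon> \<le> e / 3" "a + \<epsilon> \<le> x" "x + \<epsilon> \<le> b"
    using e a b unfolding \<epsilon>_def by linarith+
  obtain V where V: "\<And>i. random_variable borel (V i)"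
    and conv: "weak_conv_along F (\<lambda>i. distr M borel (V i)) \<nu>"
    and near: "\<forall>\<^sub>F i in F. prob {\<omega> \<in> space M. \<bar>U i \<omega> - V i \<omega>\<bar> \<ge> \<epsilon>} \<le> \<epsilon>"
    using approx[OF \<epsilon>(1)] by auto
  have conv_cdf: "\<forall>\<^sub>F i in F. dist (cdf (distr M borel (V i)) y) (cdf \<nu> y) < e / 3"
    if "isCont (cdf \<nu>) y" for y
    by (rule tendstoD) (use conv that e in \<open>auto simp: weak_conv_along_def\<close>)
  from U near conv_cdf[OF a(3)] conv_cdf[OF b(3)] show "\<forall>\<^sub>F i in F. dist (cdf (distr M borel (U i)) x) (cdf \<nu> x) < e"
  proof eventually_elim
    case (elim i)
    have "cdf (distr M borel (U i)) x \<le> cdf (distr M borel (V i)) b + \<epsilon>"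
      using cdf_distr_le_add_prob[OF elim(1) V[of i] \<epsilon>(4)] elim(2) by linarith
    moreover have "cdf (distr M borel (V i)) a \<le> cdf (distr M borel (U i)) x + \<epsilon>"
      using cdf_distr_le_add_prob[OF V[of i] elim(1) \<epsilon>(3)] elim(2)
      by (simp add: abs_minus_commute)
    moreover have "dist (cdf \<nu> a) (cdf \<nu> x) < e / 3" "dist (cdf \<nu> b) (cdf \<nu> x) < e / 3"
      using a b by (intro close; simp add: dist_real_def)+
    ultimately show ?case
      using elim(3,4) \<epsilon>(2) unfolding dist_real_def by linarith
  qed
qed

text \<open>The window from \<open>n\<close> to \<open>(1 + \<eta>) * n\<close> reaches up to
  \<open>t\<close>, so \<open>\<rho>\<close> can miss it only by falling below \<open>n\<close>;
  Markov's inequality controls that event. The maximum over the window covers every index in it at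
  once, hence any dependence between \<open>\<rho>\<close> and \<open>Y\<close> is allowed.\<close>

lemma unif_cont_in_prob_random_index:
  fixes Y :: "nat \<Rightarrow> 'a \<Rightarrow> real" and \<rho> :: "'a \<Rightarrow> nat"
  assumes [measurable]: "\<And>n. random_variable borel (Y n)" "random_variable (count_space UNIV) \<rho>"
    and unif: "prob {\<omega> \<in> space M.
        Max ((\<lambda>k. \<bar>Y (n + k) \<omega> - Y n \<omega>\<bar>) ` {k. real k \<le> \<eta> * real n}) \<ge> \<epsilon>} < \<epsilon>"
    and \<eta>: "0 < \<eta>" and n: "n = nat \<lceil>t / (1 + \<eta>)\<rceil>" and t: "0 < t"
    and \<rho>: "AE \<omega> in M. real (\<rho> \<omega>) \<le> t"
    and int: "integrable M (\<lambda>\<omega>. real (\<rho> \<omega>) / t)"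
  shows "prob {\<omega> \<in> space M. \<bar>Y (\<rho> \<omega>) \<omega> - Y n \<omega>\<bar> \<ge> \<epsilon>} \<le>
    \<epsilon> + expectation (\<lambda>\<omega>. \<bar>real (\<rho> \<omega>) / t - 1\<bar>) / (\<eta> / (1 + \<eta>))"
proof -
  define K where "K = {k. real k \<le> \<eta> * real n}"
  have "finite K"
    by (rule finite_subset[of _ "{..nat \<lfloor>\<eta> * real n\<rfloor>}"]) (auto simp: K_def le_nat_floor)
  moreover have "0 \<in> K"
    using \<eta> by (simp add: K_def)
  \<comment> \<open>Finiteness and nonemptiness of \<open>K\<close> turn the maximum into an
    existential, whose event is measurable.\<close>
  ultimately have Max_ge: "Max ((\<lambda>k. \<bar>Y (n + k) \<omega> - Y n \<omega>\<bar>) ` K) \<ge> \<epsilon> \<longleftrightarrow>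
      (\<exists>k\<in>K. \<bar>Y (n + k) \<omega> - Y n \<omega>\<bar> \<ge> \<epsilon>)" for \<omega>
    by (subst Max_ge_iff) auto
  have n_ge: "t / (1 + \<eta>) \<le> real n"
    unfolding n by linarith
  then have "t \<le> real n + \<eta> * real n"
    using \<eta> by (simp add: field_simps)
  let ?A = "{\<omega> \<in> space M. \<exists>k\<in>K. \<bar>Y (n + k) \<omega> - Y n \<omega>\<bar> \<ge> \<epsilon>}"
  let ?B = "{\<omega> \<in> space M. \<bar>real (\<rho> \<omega>) / t - 1\<bar> \<ge> \<eta> / (1 + \<eta>)}"
  have [measurable]: "(\<lambda>\<omega>. Y (\<rho> \<omega>) \<omega>) \<in> borel_measurable M"
    by (rule measurable_compose_countable) measurable
  have meas: "?A \<in> events" "?B \<in> events"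
    by measurable
  have AE: "AE \<omega> in M. \<omega> \<in> {\<omega> \<in> space M. \<bar>Y (\<rho> \<omega>) \<omega> - Y n \<omega>\<bar> \<ge> \<epsilon>} \<longrightarrow> \<omega> \<in> ?A \<union> ?B"
    using \<rho>
  proof eventually_elim
    case (elim \<omega>)
    show ?case
    proof (cases "n \<le> \<rho> \<omega>")
      case True
      then have "\<rho> \<omega> - n \<in> K"
        using elim \<open>t \<le> real n + \<eta> * real n\<close> by (simp add: K_def of_nat_diff)
      with True show ?thesis
        by (auto intro!: bexI[of _ "\<rho> \<omega> - n"])
    next
      case False
      \<comment> \<open>An integer below the ceiling \<open>n\<close> lies below
        \<open>t / (1 + \<eta>)\<close> itself, so the ratio to \<open>t\<close> is off from 1 by
        more than \<open>\<eta> / (1 + \<eta>)\<close>.\<close>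
      then have "real (\<rho> \<omega>) < t / (1 + \<eta>)"
        unfolding n by linarith
      then have "real (\<rho> \<omega>) / t < 1 / (1 + \<eta>)"
        using t \<eta> by (simp add: field_simps)
      moreover have "1 / (1 + \<eta>) = 1 - \<eta> / (1 + \<eta>)"
        using \<eta> by (simp add: field_simps)
      ultimately show ?thesis
        by auto
    qed
  qed
  have "prob {\<omega> \<in> space M. \<bar>Y (\<rho> \<omega>) \<omega> - Y n \<omega>\<bar> \<ge> \<epsilon>} \<le> prob (?A \<union> ?B)"
    using AE meas by (intro finite_measure_mono_AE) auto
  also have "\<dots> \<le> prob ?A + prob ?B"
    by (rule measure_Un_le[OF meas])
  also have "prob ?A \<le> \<epsilon>"
    using unif by (simp add: K_def[symmetric] Max_ge)
  also have "prob ?B \<le> expectation (\<lambda>\<omega>. \<bar>real (\<rho> \<omega>) / t - 1\<bar>) / (\<eta> / (1 + \<eta>))"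
    by (rule integral_Markov_inequality_measure[where A = "space M"]) (use int \<eta> in auto)
  finally show ?thesis
    by simp
qed

section \<open>Second moment versus variance\<close>

lemma centered_square_integrable_iff:
  fixes X :: "'a \<Rightarrow> real"
  assumes X: "integrable M X"
  shows "integrable M (\<lambda>\<omega>. (X \<omega> - c)\<^sup>2) \<longleftrightarrow> integrable M (\<lambda>\<omega>. (X \<omega>)\<^sup>2)"
proof
  assume "integrable M (\<lambda>\<omega>. (X \<omega> - c)\<^sup>2)"
  then have "integrable M (\<lambda>\<omega>. (X \<omega> - c)\<^sup>2 + (2 * c * X \<omega> - c\<^sup>2))"
    using X by (intro Bochner_Integration.integrable_add) auto
  then show "integrable M (\<lambda>\<omega>. (X \<omega>)\<^sup>2)"
    by (simp add: power2_diff algebra_simps)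
next
  assume "integrable M (\<lambda>\<omega>. (X \<omega>)\<^sup>2)"
  then show "integrable M (\<lambda>\<omega>. (X \<omega> - c)\<^sup>2)"
    using X unfolding power2_diff by auto
qed

text \<open>With mean \<open>\<delta>\<close>, second moment and variance differ by
  \<open>\<delta>\<^sup>2\<close>, which is absorbed by the bound. Integrability is matched first,
  since the variance formula relies on it.\<close>

lemma second_moment_bigo_iff_variance_bigo:
  fixes X :: "real \<Rightarrow> 'a \<Rightarrow> real"
  assumes int: "\<forall>\<^sub>F \<delta> in F. integrable M (X \<delta>)" and mean: "\<forall>\<^sub>F \<delta> in F. expectation (X \<delta>) = \<delta>"
  shows "expectation_bigo M F (\<lambda>\<delta> \<omega>. (X \<delta> \<omega>)\<^sup>2) (\<lambda>\<delta>. \<delta>\<^sup>2) \<longleftrightarrow>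
    expectation_bigo M F (\<lambda>\<delta> \<omega>. (X \<delta> \<omega> - expectation (X \<delta>))\<^sup>2) (\<lambda>\<delta>. \<delta>\<^sup>2)"
proof -
  have iff: "(\<forall>\<^sub>F \<delta> in F. integrable M (\<lambda>\<omega>. (X \<delta> \<omega>)\<^sup>2)) \<longleftrightarrow>
      (\<forall>\<^sub>F \<delta> in F. integrable M (\<lambda>\<omega>. (X \<delta> \<omega> - expectation (X \<delta>))\<^sup>2))"
    by (rule eventually_cong[OF int]) (simp add: centered_square_integrable_iff)
  have "(\<lambda>\<delta>. expectation (\<lambda>\<omega>. (X \<delta> \<omega>)\<^sup>2)) \<in> O[F](\<lambda>\<delta>. \<delta>\<^sup>2) \<longleftrightarrow>
      (\<lambda>\<delta>. variance (X \<delta>)) \<in> O[F](\<lambda>\<delta>. \<delta>\<^sup>2)"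
    if "\<forall>\<^sub>F \<delta> in F. integrable M (\<lambda>\<omega>. (X \<delta> \<omega>)\<^sup>2)"
  proof -
    have eq: "\<forall>\<^sub>F \<delta> in F. expectation (\<lambda>\<omega>. (X \<delta> \<omega>)\<^sup>2) = variance (X \<delta>) + \<delta>\<^sup>2"
      using that int mean
    proof eventually_elim
      case (elim \<delta>)
      then show ?case
        using variance_eq[OF elim(2,1)] by simp
    qed
    have "(\<lambda>\<delta>. expectation (\<lambda>\<omega>. (X \<delta> \<omega>)\<^sup>2)) \<in> O[F](\<lambda>\<delta>. \<delta>\<^sup>2) \<longleftrightarrow>
        (\<lambda>\<delta>. variance (X \<delta>) + \<delta>\<^sup>2) \<in> O[F](\<lambda>\<delta>. \<delta>\<^sup>2)"
      by (rule landau_o.big.in_cong[OF eq])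
    also have "\<dots> \<longleftrightarrow> (\<lambda>\<delta>. variance (X \<delta>)) \<in> O[F](\<lambda>\<delta>. \<delta>\<^sup>2)"
      using sum_in_bigo(2)[of "\<lambda>\<delta>. variance (X \<delta>) + \<delta>\<^sup>2" F "\<lambda>\<delta>. \<delta>\<^sup>2" "\<lambda>\<delta>. \<delta>\<^sup>2"]
        sum_in_bigo(1)[of "\<lambda>\<delta>. variance (X \<delta>)" F "\<lambda>\<delta>. \<delta>\<^sup>2" "\<lambda>\<delta>. \<delta>\<^sup>2"] by auto
    finally show ?thesis .
  qed
  with iff show ?thesis
    unfolding expectation_bigo_def by blast
qed

section \<open>The joint limit\<close>

lemma last_renewal_tendsto_L1:
  fixes \<tau> :: "real \<Rightarrow> nat \<Rightarrow> 'a \<Rightarrow> nat"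
  assumes ren: "\<And>\<delta>. \<delta> \<in> D \<Longrightarrow> renewal_process M (\<tau> \<delta>)"
    and int: "\<And>\<delta>. \<delta> \<in> D \<Longrightarrow> integrable M (\<lambda>\<omega>. real (\<tau> \<delta> 1 \<omega>))"
    and mean: "\<And>\<delta>. \<delta> \<in> D \<Longrightarrow> expectation (\<lambda>\<omega>. real (\<tau> \<delta> 1 \<omega>)) = \<delta>"
    and bigo: "expectation_bigo M (inf at_top (principal D))
      (\<lambda>\<delta> \<omega>. (real (\<tau> \<delta> 1 \<omega>))\<^sup>2) (\<lambda>\<delta>. \<delta>\<^sup>2)"
    and lim: "joint_limit D F d t"
  shows "tendsto_L1 M F (\<lambda>i \<omega>. real (last_renewal (\<tau> (d i)) (t i) \<omega>) / t i) (\<lambda>_. 1)"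
proof -
  have dD: "\<forall>\<^sub>F i in F. d i \<in> D" and d: "filterlim d at_top F" and t: "filterlim t at_top F"
    and ratio: "((\<lambda>i. d i / t i) \<longlongrightarrow> 0) F"
    using lim by (auto simp: joint_limit_def)
  \<comment> \<open>Estimates that hold eventually for \<open>\<delta>\<close> in \<open>D\<close>
    can now be pulled back along the net \<open>d\<close>.\<close>
  have d': "filterlim d (inf at_top (principal D)) F"
    using d dD by (simp add: filterlim_inf filterlim_principal)
  obtain C where C: "C > 0" and bound: "\<forall>\<^sub>F \<delta> in inf at_top (principal D).
      norm (expectation (\<lambda>\<omega>. (real (\<tau> \<delta> 1 \<omega>))\<^sup>2)) \<le> C * norm (\<delta>\<^sup>2)"
    using bigo unfolding expectation_bigo_def by (auto elim!: landau_o.bigE)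
  have int2: "\<forall>\<^sub>F \<delta> in inf at_top (principal D). integrable M (\<lambda>\<omega>. (real (\<tau> \<delta> 1 \<omega>))\<^sup>2)"
    using bigo unfolding expectation_bigo_def by auto
  have t_pos: "\<forall>\<^sub>F i in F. 0 < t i"
    using t by (simp add: filterlim_at_top_dense)
  have key: "\<forall>\<^sub>F i in F. integrable M (\<lambda>\<omega>. real (last_renewal (\<tau> (d i)) (t i) \<omega>) / t i) \<and>
      expectation (\<lambda>\<omega>. \<bar>real (last_renewal (\<tau> (d i)) (t i) \<omega>) / t i - 1\<bar>) \<le>
        C * (d i / t i) + sqrt (C * (d i / t i))"
    using dD t_pos eventually_compose_filterlim[OF bound d'] eventually_compose_filterlim[OF int2 d']
  proof eventually_elim
    case (elim i)
    have second: "expectation (\<lambda>\<omega>. (real (\<tau> (d i) 1 \<omega>))\<^sup>2) \<le> C * (d i)\<^sup>2"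
      using elim(3) by simp
    note lag = renewal_lag_bound[OF ren[OF elim(1)] less_imp_le[OF elim(2)] less_imp_le[OF C]
        int[OF elim(1)] mean[OF elim(1)] elim(4) second]
    let ?L = "\<lambda>\<omega>. real (last_renewal (\<tau> (d i)) (t i) \<omega>)"
    have "\<bar>?L \<omega> / t i - 1\<bar> = \<bar>t i - ?L \<omega>\<bar> / t i" for \<omega>
      using elim(2) by (simp add: abs_if field_simps)
    then have "expectation (\<lambda>\<omega>. \<bar>?L \<omega> / t i - 1\<bar>) = expectation (\<lambda>\<omega>. \<bar>t i - ?L \<omega>\<bar>) / t i"
      by simp
    also have "\<dots> \<le> (C * d i + sqrt (C * d i * t i)) / t i"
      using lag(2) elim(2) by (simp add: divide_right_mono)
    also have "\<dots> = C * (d i / t i) + sqrt (C * (d i / t i))"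
    proof -
      have "sqrt (C * d i * t i) / t i = sqrt (C * d i * t i / (t i)\<^sup>2)"
        using elim(2) by (simp add: real_sqrt_divide)
      also have "C * d i * t i / (t i)\<^sup>2 = C * (d i / t i)"
        using elim(2) by (simp add: power2_eq_square)
      finally show ?thesis
        by (simp add: add_divide_distrib)
    qed
    finally show ?case
      using lag(1) by simp
  qed
  have "((\<lambda>i. C * (d i / t i) + sqrt (C * (d i / t i))) \<longlongrightarrow> C * 0 + sqrt (C * 0)) F"
    by (intro tendsto_intros ratio)
  then have "((\<lambda>i. C * (d i / t i) + sqrt (C * (d i / t i))) \<longlongrightarrow> 0) F"
    by simp
  then have "((\<lambda>i. expectation (\<lambda>\<omega>. \<bar>real (last_renewal (\<tau> (d i)) (t i) \<omega>) / t i - 1\<bar>)) \<longlongrightarrow> 0) F"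
    by (rule tendsto_sandwich[OF _ _ tendsto_const, rotated 2])
      (use key in \<open>auto elim!: eventually_mono\<close>)
  with key show ?thesis
    by (auto simp: tendsto_L1_def elim!: eventually_mono)
qed

text \<open>No renewal structure enters: an index below \<open>t\<close> with ratio to
  \<open>t\<close> tending to 1 in mean can be replaced by a deterministic time \<open>n i\<close>,
  at which the assumed weak convergence applies.\<close>

lemma weak_conv_random_index:
  fixes Y :: "nat \<Rightarrow> 'a \<Rightarrow> real" and \<rho> :: "'i \<Rightarrow> 'a \<Rightarrow> nat"
  assumes Y: "\<And>n. random_variable borel (Y n)"
    and unif: "unif_cont_in_prob M Y"
    and \<nu>: "real_distribution \<nu>"
    and conv: "weak_conv_m (\<lambda>n. distr M borel (Y n)) \<nu>"
    and t: "filterlim t at_top F"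
    and meas: "\<forall>\<^sub>F i in F. random_variable (count_space UNIV) (\<rho> i)"
    and le: "\<forall>\<^sub>F i in F. AE \<omega> in M. real (\<rho> i \<omega>) \<le> t i"
    and L1: "tendsto_L1 M F (\<lambda>i \<omega>. real (\<rho> i \<omega>) / t i) (\<lambda>_. 1)"
  shows "weak_conv_along F (\<lambda>i. distr M borel (\<lambda>\<omega>. Y (\<rho> i \<omega>) \<omega>)) \<nu>"
proof (rule weak_conv_along_approx[OF \<nu>])
  show "\<forall>\<^sub>F i in F. random_variable borel (\<lambda>\<omega>. Y (\<rho> i \<omega>) \<omega>)"
    using meas by eventually_elim (rule measurable_compose_countable[OF Y])
  fix \<epsilon> :: real
  assume \<epsilon>: "0 < \<epsilon>"
  \<comment> \<open>Half of \<open>\<epsilon>\<close> is for leaving the tolerance inside the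
    window, the other half for the Markov term.\<close>
  obtain \<eta> where \<eta>: "0 < \<eta>" and small: "\<And>n. n \<ge> 1 \<Longrightarrow> prob {\<omega> \<in> space M.
        Max ((\<lambda>k. \<bar>Y (n + k) \<omega> - Y n \<omega>\<bar>) ` {k. real k \<le> \<eta> * real n}) \<ge> \<epsilon> / 2} < \<epsilon> / 2"
    using unif half_gt_zero[OF \<epsilon>] unfolding unif_cont_in_prob_def by blast
  define n where "n i = nat \<lceil>t i / (1 + \<eta>)\<rceil>" for i
  have n: "filterlim n at_top F"
    unfolding filterlim_at_top
  proof
    fix Z :: nat
    have "\<forall>\<^sub>F i in F. real Z * (1 + \<eta>) \<le> t i"
      using t by (simp add: filterlim_at_top)
    then show "\<forall>\<^sub>F i in F. Z \<le> n i"
    proof eventually_elim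
      case (elim i)
      then have "real Z \<le> t i / (1 + \<eta>)"
        using \<eta> by (simp add: field_simps)
      then show ?case
        unfolding n_def by linarith
    qed
  qed
  have conv': "weak_conv_along F (\<lambda>i. distr M borel (Y (n i))) \<nu>"
    using conv filterlim_compose[OF _ n]
    unfolding weak_conv_along_sequentially[symmetric] weak_conv_along_def by blast
  define L where "L i = expectation (\<lambda>\<omega>. \<bar>real (\<rho> i \<omega>) / t i - 1\<bar>)" for i
  have int: "\<forall>\<^sub>F i in F. integrable M (\<lambda>\<omega>. real (\<rho> i \<omega>) / t i)" and L: "(L \<longlongrightarrow> 0) F"
    using L1 by (auto simp: tendsto_L1_def L_def[abs_def])
  have "((\<lambda>i. L i / (\<eta> / (1 + \<eta>))) \<longlongrightarrow> 0 / (\<eta> / (1 + \<eta>))) F"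
    using \<eta> by (intro tendsto_intros L) auto
  then have L_small: "\<forall>\<^sub>F i in F. L i / (\<eta> / (1 + \<eta>)) < \<epsilon> / 2"
    using \<epsilon> by (intro order_tendstoD(2)) auto
  have t_pos: "\<forall>\<^sub>F i in F. 0 < t i"
    using t by (simp add: filterlim_at_top_dense)
  have n_pos: "\<forall>\<^sub>F i in F. 1 \<le> n i"
    using n by (simp add: filterlim_at_top)
  from int L_small t_pos n_pos meas le
  have "\<forall>\<^sub>F i in F. prob {\<omega> \<in> space M. \<bar>Y (\<rho> i \<omega>) \<omega> - Y (n i) \<omega>\<bar> \<ge> \<epsilon>} \<le> \<epsilon>"
  proof eventually_elim
    case (elim i)
    note [measurable] = Y elim(5)
    have [measurable]: "(\<lambda>\<omega>. Y (\<rho> i \<omega>) \<omega>) \<in> borel_measurable M"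
      by (rule measurable_compose_countable) measurable
    \<comment> \<open>Lowering the threshold to \<open>\<epsilon> / 2\<close> only enlarges the
      event and matches the choice of \<open>\<eta>\<close>.\<close>
    have "prob {\<omega> \<in> space M. \<bar>Y (\<rho> i \<omega>) \<omega> - Y (n i) \<omega>\<bar> \<ge> \<epsilon>} \<le>
        prob {\<omega> \<in> space M. \<bar>Y (\<rho> i \<omega>) \<omega> - Y (n i) \<omega>\<bar> \<ge> \<epsilon> / 2}"
      using \<epsilon> by (intro finite_measure_mono) auto
    also have "\<dots> \<le> \<epsilon> / 2 + L i / (\<eta> / (1 + \<eta>))"
      unfolding L_def
      by (rule unif_cont_in_prob_random_index[OF Y elim(5) small[OF elim(4)] \<eta> n_def
            elim(3) elim(6) elim(1)])
    finally show ?case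
      using elim(2) by linarith
  qed
  with Y conv' show "\<exists>V. (\<forall>i. random_variable borel (V i)) \<and>
      weak_conv_along F (\<lambda>i. distr M borel (V i)) \<nu> \<and>
      (\<forall>\<^sub>F i in F. prob {\<omega> \<in> space M. \<bar>Y (\<rho> i \<omega>) \<omega> - V i \<omega>\<bar> \<ge> \<epsilon>} \<le> \<epsilon>)"
    by (intro exI[of _ "\<lambda>i. Y (n i)"]) auto
qed

end

theorem theorem2p4:
  fixes M :: "'a measure" and M' :: "'b measure"
    and Y :: "nat \<Rightarrow> 'a \<Rightarrow> real" and Y_inf :: "'b \<Rightarrow> real"
    and D :: "real set"
    and \<tau> :: "real \<Rightarrow> nat \<Rightarrow> 'a \<Rightarrow> nat"
  assumes "prob_space M" and "prob_space M'"
    and "\<And>n. Y n \<in> borel_measurable M"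
    and "Y_inf \<in> borel_measurable M'"
    and "unif_cont_in_prob M Y"
    and "weak_conv_m (\<lambda>n. distr M borel (Y n)) (distr M' borel Y_inf)"
    and "\<And>\<delta>. \<delta> \<in> D \<Longrightarrow> renewal_process M (\<tau> \<delta>)"
    and "\<And>\<delta>. \<delta> \<in> D \<Longrightarrow> integrable M (\<lambda>\<omega>. real (\<tau> \<delta> 1 \<omega>))"
    and "\<And>\<delta>. \<delta> \<in> D \<Longrightarrow> (\<integral>\<omega>. real (\<tau> \<delta> 1 \<omega>) \<partial>M) = \<delta>"
  shows
    "(expectation_bigo M (inf at_top (principal D))
        (\<lambda>\<delta> \<omega>. (real (\<tau> \<delta> 1 \<omega>))\<^sup>2) (\<lambda>\<delta>. \<delta>\<^sup>2)
      \<longleftrightarrow>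
      expectation_bigo M (inf at_top (principal D))
        (\<lambda>\<delta> \<omega>. (real (\<tau> \<delta> 1 \<omega>) - (\<integral>\<omega>'. real (\<tau> \<delta> 1 \<omega>') \<partial>M))\<^sup>2) (\<lambda>\<delta>. \<delta>\<^sup>2))
     \<and>
     (expectation_bigo M (inf at_top (principal D))
        (\<lambda>\<delta> \<omega>. (real (\<tau> \<delta> 1 \<omega>))\<^sup>2) (\<lambda>\<delta>. \<delta>\<^sup>2)
      \<longrightarrow>
      (\<forall>(F :: 'i filter) d t. joint_limit D F d t \<longrightarrow>
        tendsto_L1 M F (\<lambda>i \<omega>. real (last_renewal (\<tau> (d i)) (t i) \<omega>) / t i) (\<lambda>_. 1) \<and>
        weak_conv_along F
          (\<lambda>i. distr M borel (\<lambda>\<omega>. Y (last_renewal (\<tau> (d i)) (t i) \<omega>) \<omega>))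
          (distr M' borel Y_inf)))"
proof -
  interpret prob_space M by fact
  interpret M': prob_space M' by fact
  note ren = assms(7) and int = assms(8) and mean = assms(9)
  have D: "\<forall>\<^sub>F \<delta> in inf at_top (principal D). \<delta> \<in> D"
    by (simp add: eventually_inf_principal)
  have "real_distribution (distr M' borel Y_inf)"
    using assms(4) by (rule M'.real_distribution_distr)
  then have "weak_conv_along F
      (\<lambda>i. distr M borel (\<lambda>\<omega>. Y (last_renewal (\<tau> (d i)) (t i) \<omega>) \<omega>)) (distr M' borel Y_inf)"
    if lim: "joint_limit D F d t"
      and L1: "tendsto_L1 M F (\<lambda>i \<omega>. real (last_renewal (\<tau> (d i)) (t i) \<omega>) / t i) (\<lambda>_. 1)"
    for F :: "'i filter" and d t
  proof (rule weak_conv_random_index[OF assms(3,5) _ assms(6)])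
    have dD: "\<forall>\<^sub>F i in F. d i \<in> D"
      using lim by (simp add: joint_limit_def)
    show t: "filterlim t at_top F"
      using lim by (simp add: joint_limit_def)
    \<comment> \<open>For negative \<open>t\<close> the set defining \<open>renewal_count\<close>
      would almost surely be empty, so the bound on \<open>last_renewal\<close> is claimed only
      eventually.\<close>
    then have "\<forall>\<^sub>F i in F. 0 < t i"
      by (simp add: filterlim_at_top_dense)
    with dD show "\<forall>\<^sub>F i in F. AE \<omega> in M. real (last_renewal (\<tau> (d i)) (t i) \<omega>) \<le> t i"
    proof eventually_elim
      case (elim i)
      show ?case
        using renewal_process_AE[OF ren[OF elim(1)]]
        by eventually_elim (use elim(2) in \<open>auto intro: renewal_count_bounds(3)\<close>)
    qed
    show "\<forall>\<^sub>F i in F. random_variable (count_space UNIV) (last_renewal (\<tau> (d i)) (t i))"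
      using dD by eventually_elim (rule renewal_process_measurable(4)[OF ren])
  qed (use L1 in simp)
  moreover have "expectation_bigo M (inf at_top (principal D))
        (\<lambda>\<delta> \<omega>. (real (\<tau> \<delta> 1 \<omega>))\<^sup>2) (\<lambda>\<delta>. \<delta>\<^sup>2) \<longleftrightarrow>
      expectation_bigo M (inf at_top (principal D))
        (\<lambda>\<delta> \<omega>. (real (\<tau> \<delta> 1 \<omega>) - (\<integral>\<omega>'. real (\<tau> \<delta> 1 \<omega>') \<partial>M))\<^sup>2) (\<lambda>\<delta>. \<delta>\<^sup>2)"
    using D by (intro second_moment_bigo_iff_variance_bigo)
      (use int mean in \<open>auto elim!: eventually_mono\<close>)
  ultimately show ?thesis
    using last_renewal_tendsto_L1[of D \<tau>, OF ren int mean] by blast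
qed

end
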